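(* The tetrablock $\mathbb{E}\subset\mathbb{C}^3$ is not Gromov $k$-hyperbolic.
   Context: Let $\mathcal{R}_{II}$ be the set of symmetric $2\times 2$ complex matrices of operator norm $<1$, where the matrix $\begin{pmatrix} z_{11}&z\\ z&z_{22}\end{pmatrix}$ is identified with the point $(z_{11},z_{22},z)\in\mathbb{C}^3$. Let $\varphi(z_{11},z_{22},z)=(z_{11},z_{22},z_{11}z_{22}-z^2)$. The tetrablock is the domain $\mathbb{E}=\varphi(\mathcal{R}_{II})\subset\mathbb{C}^3$. Let $\mathbb{D}$ be the open unit disc in $\mathbb{C}$. For a domain $D\subset\mathbb{C}^n$, the Lempert function is $l_D(z,w)=\inf\{\tanh^{-1}|\alpha| : \exists\,f:\mathbb{D}\to D \text{ holomorphic with } f(0)=z,\ f(\alpha)=w\}$, and the Kobayashi distance $k_D$ is the largest pseudodistance on $D$ not exceeding $l_D$. For a metric space $(X,d)$ and $x,y,z\in X$, the Gromov product is $(x,y)_z=d(x,z)+d(z,y)-d(x,y)$. Put $S_d(p,q,x,w)=\min\{(p,x)_w,(x,q)_w\}-(p,q)_w$. The space $(X,d)$ is Gromov hyperbolic if $\sup_{p,q,x,w\in X}S_d(p,q,x,w)<\infty$. A domain $D$ is Gromov $k$-hyperbolic if $(D,k_D)$ is Gromov hyperbolic. *)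

theory Defs
  imports "HOL-Analysis.Analysis"
begin

section \<open>The tetrablock\<close>

text \<open>
  The norm on \<^typ>\<open>complex^2\<close> is the Hermitian one, so \<^const>\<open>onorm\<close> below is the usual
  operator (spectral) norm of a complex matrix.
\<close>

definition R_II :: "(complex^2^2) set" where
  "R_II = {A. transpose A = A \<and> onorm ((*v) A) < 1}"

definition sym_coords :: "complex^2^2 \<Rightarrow> complex^3" where
  "sym_coords A = vector [A $ 1 $ 1, A $ 2 $ 2, A $ 1 $ 2]"

definition tetra_map :: "complex^3 \<Rightarrow> complex^3" where
  "tetra_map p = vector [p $ 1, p $ 2, p $ 1 * p $ 2 - (p $ 3)\<^sup>2]"

definition tetrablock :: "(complex^3) set" where
  "tetrablock = tetra_map ` sym_coords ` R_II"


section \<open>Lempert function and Kobayashi distance\<close>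

definition holomorphic_discs :: "(complex^'n) set \<Rightarrow> (complex \<Rightarrow> complex^'n) set" where
  "holomorphic_discs D =
     {f. (\<forall>i. (\<lambda>\<zeta>. f \<zeta> $ i) holomorphic_on ball 0 1) \<and> f ` ball 0 1 \<subseteq> D}"

text \<open>Extended real values: the infimum over the empty set is \<open>\<infinity>\<close>.\<close>

definition lempert :: "(complex^'n) set \<Rightarrow> complex^'n \<Rightarrow> complex^'n \<Rightarrow> ereal" where
  "lempert D z w =
     (INF \<alpha> \<in> {\<alpha> \<in> ball 0 1. \<exists>f \<in> holomorphic_discs D. f 0 = z \<and> f \<alpha> = w}.
        ereal (artanh (cmod \<alpha>)))"

definition pseudodistance_on :: "'a set \<Rightarrow> ('a \<Rightarrow> 'a \<Rightarrow> real) \<Rightarrow> bool" where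
  "pseudodistance_on X d \<longleftrightarrow>
     (\<forall>x\<in>X. d x x = 0) \<and>
     (\<forall>x\<in>X. \<forall>y\<in>X. 0 \<le> d x y \<and> d x y = d y x) \<and>
     (\<forall>x\<in>X. \<forall>y\<in>X. \<forall>z\<in>X. d x z \<le> d x y + d y z)"

definition below_lempert :: "(complex^'n) set \<Rightarrow> (complex^'n \<Rightarrow> complex^'n \<Rightarrow> real) \<Rightarrow> bool" where
  "below_lempert D d \<longleftrightarrow> (\<forall>z\<in>D. \<forall>w\<in>D. ereal (d z w) \<le> lempert D z w)"

text \<open>
  The largest pseudodistance below the Lempert function, as a pointwise supremum.
  That it is indeed the largest one is shown in \<open>kobayashi_dist_largest\<close> for sets in which
  one point has finite Lempert function to every other, and in \<open>kobayashi_dist_tetrablock\<close>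
  for the tetrablock.  Only its values on \<open>D\<close> are meaningful.
\<close>

definition kobayashi_dist :: "(complex^'n) set \<Rightarrow> complex^'n \<Rightarrow> complex^'n \<Rightarrow> real" where
  "kobayashi_dist D z w = (SUP d \<in> {d. pseudodistance_on D d \<and> below_lempert D d}. d z w)"


section \<open>Gromov hyperbolicity\<close>

text \<open>The Gromov product is normalised without the factor \<open>1/2\<close>.\<close>

definition gromov_product :: "('a \<Rightarrow> 'a \<Rightarrow> real) \<Rightarrow> 'a \<Rightarrow> 'a \<Rightarrow> 'a \<Rightarrow> real" where
  "gromov_product d x y z = d x z + d z y - d x y"

definition gromov_S :: "('a \<Rightarrow> 'a \<Rightarrow> real) \<Rightarrow> 'a \<Rightarrow> 'a \<Rightarrow> 'a \<Rightarrow> 'a \<Rightarrow> real" where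
  "gromov_S d p q x w =
     min (gromov_product d p x w) (gromov_product d x q w) - gromov_product d p q w"

definition gromov_hyperbolic_on :: "'a set \<Rightarrow> ('a \<Rightarrow> 'a \<Rightarrow> real) \<Rightarrow> bool" where
  "gromov_hyperbolic_on X d \<longleftrightarrow>
     bdd_above {gromov_S d p q x w | p q x w. p \<in> X \<and> q \<in> X \<and> x \<in> X \<and> w \<in> X}"

definition gromov_k_hyperbolic :: "(complex^'n) set \<Rightarrow> bool" where
  "gromov_k_hyperbolic D \<longleftrightarrow> gromov_hyperbolic_on D (kobayashi_dist D)"


section \<open>The Kobayashi distance is well defined\<close>

lemma lempert_nonneg: "0 \<le> lempert D z w"
  unfolding lempert_def
proof (rule INF_greatest)
  fix \<alpha> :: complex
  assume "\<alpha> \<in> {\<alpha> \<in> ball 0 1. \<exists>f \<in> holomorphic_discs D. f 0 = z \<and> f \<alpha> = w}"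
  then have "cmod \<alpha> < 1" by simp
  then show "0 \<le> ereal (artanh (cmod \<alpha>))"
    by (simp add: artanh_def field_simps)
qed

lemma kobayashi_dist_largest:
  fixes D :: "(complex^'n) set"
  assumes c: "c \<in> D" and fin: "\<And>z. z \<in> D \<Longrightarrow> lempert D c z < \<infinity>"
  shows "pseudodistance_on D (kobayashi_dist D)"
    and "below_lempert D (kobayashi_dist D)"
    and "\<lbrakk>pseudodistance_on D d; below_lempert D d; z \<in> D; w \<in> D\<rbrakk> \<Longrightarrow> d z w \<le> kobayashi_dist D z w"
proof -
  define \<D> where "\<D> = {d. pseudodistance_on D d \<and> below_lempert D d}"
  define k where "k = kobayashi_dist D"
  have k: "k z w = (SUP d \<in> \<D>. d z w)" for z w
    by (simp add: k_def \<D>_def kobayashi_dist_def)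
  have zero: "(\<lambda>_ _. 0) \<in> \<D>"
    by (simp add: \<D>_def pseudodistance_on_def below_lempert_def lempert_nonneg flip: zero_ereal_def)
  then have ne: "\<D> \<noteq> {}" by auto
  have dc: "d c z \<le> real_of_ereal (lempert D c z)" if "d \<in> \<D>" "z \<in> D" for d z
  proof -
    have "ereal (d c z) \<le> lempert D c z"
      using that c by (auto simp: \<D>_def below_lempert_def)
    then show ?thesis using fin[OF that(2)] by (cases "lempert D c z") auto
  qed
  have bdd: "bdd_above ((\<lambda>d. d z w) ` \<D>)" if "z \<in> D" "w \<in> D" for z w
  proof (rule bdd_aboveI2)
    fix d assume d: "d \<in> \<D>"
    have "d z w \<le> d z c + d c w" "d z c = d c z"
      using d that c unfolding \<D>_def pseudodistance_on_def by auto
    then show "d z w \<le> real_of_ereal (lempert D c z) + real_of_ereal (lempert D c w)"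
      using dc[OF d that(1)] dc[OF d that(2)] by linarith
  qed
  have up: "d z w \<le> k z w" if "d \<in> \<D>" "z \<in> D" "w \<in> D" for d z w
    unfolding k using that by (intro cSUP_upper bdd) auto
  have least: "k z w \<le> B" if "\<And>d. d \<in> \<D> \<Longrightarrow> d z w \<le> B" for z w B
    unfolding k using that by (intro cSUP_least ne) auto
  show "pseudodistance_on D (kobayashi_dist D)"
    unfolding k_def[symmetric] pseudodistance_on_def
  proof (intro conjI ballI)
    show "k x x = 0" if "x \<in> D" for x
      using up[OF zero that that] least[of x x 0] that
      by (force simp: \<D>_def pseudodistance_on_def)
    show "0 \<le> k x y" if "x \<in> D" "y \<in> D" for x y
      using up[OF zero that] .
    show "k x y = k y x" if "x \<in> D" "y \<in> D" for x y
      unfolding k using that by (intro SUP_cong) (auto simp: \<D>_def pseudodistance_on_def)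
    show "k x z \<le> k x y + k y z" if "x \<in> D" "y \<in> D" "z \<in> D" for x y z
    proof (rule least)
      fix d assume d: "d \<in> \<D>"
      then have "d x z \<le> d x y + d y z"
        using that by (auto simp: \<D>_def pseudodistance_on_def)
      then show "d x z \<le> k x y + k y z"
        using up[OF d that(1,2)] up[OF d that(2,3)] by linarith
    qed
  qed
  show "below_lempert D (kobayashi_dist D)"
    unfolding k_def[symmetric] below_lempert_def
  proof (intro ballI)
    fix z w assume zw: "z \<in> D" "w \<in> D"
    show "ereal (k z w) \<le> lempert D z w"
    proof (cases "lempert D z w")
      case (real r)
      have "d z w \<le> r" if "d \<in> \<D>" for d
      proof -
        have "ereal (d z w) \<le> lempert D z w"
          using that zw by (auto simp: \<D>_def below_lempert_def)
        then show ?thesis using real by simp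
      qed
      then show ?thesis using least real by simp
    next
      case MInf
      then show ?thesis using lempert_nonneg[of D z w] by simp
    qed simp
  qed
  show "d z w \<le> kobayashi_dist D z w"
    if "pseudodistance_on D d" "below_lempert D d" "z \<in> D" "w \<in> D"
    using up[of d z w] that by (simp add: \<D>_def k_def)
qed

lemma R_II_scale:
  assumes A: "A \<in> R_II" and c: "cmod c * onorm ((*v) A) < 1"
  shows "(\<chi> i j. c * A $ i $ j) \<in> R_II"
proof -
  let ?B = "(\<chi> i j. c * A $ i $ j) :: complex^2^2"
  have "norm (?B *v x) = cmod c * norm (A *v x)" for x
    by (simp add: norm_vec_def matrix_vector_mult_def L2_set_def norm_mult power_mult_distrib
        mult.assoc real_sqrt_mult flip: sum_distrib_left distrib_left)
  moreover have "norm (A *v x) \<le> onorm ((*v) A) * norm x" for x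
  proof -
    have "linear ((*v) A)"
      by (intro linearI)
        (simp_all add: vec_eq_iff matrix_vector_mult_def algebra_simps sum.distrib scaleR_sum_right)
    then show ?thesis by (simp add: linear_conv_bounded_linear onorm)
  qed
  ultimately have "onorm ((*v) ?B) \<le> cmod c * onorm ((*v) A)"
    by (intro onorm_le) (simp add: mult.assoc mult_left_mono)
  moreover have "transpose ?B = ?B"
    using A by (simp add: R_II_def transpose_def vec_eq_iff)
  ultimately show ?thesis using c by (simp add: R_II_def)
qed

lemma lempert_tetrablock_finite:
  assumes "z \<in> tetrablock"
  shows "lempert tetrablock 0 z < \<infinity>"
proof -
  obtain A where A: "A \<in> R_II" and z: "z = tetra_map (sym_coords A)"
    using assms by (auto simp: tetrablock_def)
  define o' where "o' = onorm ((*v) A)"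
  obtain s where s: "max 0 o' < s" "s < 1"
    using A dense[of "max 0 o'" 1] by (auto simp: R_II_def o'_def)
  define f where "f \<zeta> = tetra_map (sym_coords (\<chi> i j. (\<zeta> / of_real s) * A $ i $ j))" for \<zeta>
  have "f \<zeta> \<in> tetrablock" if "cmod \<zeta> < 1" for \<zeta>
  proof -
    have "cmod (\<zeta> / of_real s) * onorm ((*v) A) < 1"
    proof (cases "o' \<le> 0")
      case True
      then show ?thesis
        using mult_nonneg_nonpos[of "cmod (\<zeta> / of_real s)" o'] by (simp add: o'_def)
    next
      case False
      then have "cmod \<zeta> * o' < 1 * s"
        using that s by (intro mult_strict_mono) auto
      then show ?thesis using s by (simp add: o'_def norm_divide field_simps)
    qed
    then show ?thesis
      unfolding f_def tetrablock_def by (intro imageI R_II_scale A)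
  qed
  moreover have "(\<lambda>\<zeta>. f \<zeta> $ i) holomorphic_on ball 0 1" for i
    using exhaust_3[of i] s
    by (auto simp: f_def tetra_map_def sym_coords_def intro!: holomorphic_intros)
  ultimately have "f \<in> holomorphic_discs tetrablock"
    by (auto simp: holomorphic_discs_def)
  moreover have "f 0 = 0"
    by (simp add: f_def tetra_map_def sym_coords_def vec_eq_iff forall_3)
  moreover have "f (of_real s) = z"
    using s by (simp add: f_def z tetra_map_def sym_coords_def)
  ultimately have "lempert tetrablock 0 z \<le> ereal (artanh (cmod (of_real s)))"
    unfolding lempert_def using s by (intro INF_lower) auto
  then show ?thesis by (auto simp: less_top[symmetric] top_ereal_def)
qed

lemma zero_in_tetrablock: "0 \<in> tetrablock"
proof -
  have "(0 :: complex^2^2) \<in> R_II"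
    by (simp add: R_II_def transpose_def vec_eq_iff onorm_zero matrix_vector_mult_0[abs_def])
  moreover have "tetra_map (sym_coords 0) = 0"
    by (simp add: tetra_map_def sym_coords_def vec_eq_iff forall_3)
  ultimately show ?thesis unfolding tetrablock_def by force
qed

lemmas kobayashi_dist_tetrablock =
  kobayashi_dist_largest[OF zero_in_tetrablock lempert_tetrablock_finite]

end

theory Submission
  imports Defs "HOL-Complex_Analysis.Conformal_Mappings"
begin

text \<open>
  The point is that the tetrablock contains the bidisc as a holomorphic retract. The map
  \<open>(a, b) \<mapsto> (a, b, ab)\<close>, which comes from the diagonal matrices, embeds the bidisc, and
  the projection to the first two coordinates maps the tetrablock back to the bidisc, because
  an entry of a matrix is bounded by its operator norm. Holomorphic maps do not increase the
  Kobayashi distance, so the embedding is isometric, and the bidisc carries the maximum of two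
  hyperbolic distances. Since \<open>s \<mapsto> tanh s\<close> is a geodesic line in the disc, the plane with
  the maximum norm embeds isometrically into the tetrablock, and a plane with a norm is not
  Gromov hyperbolic: with \<open>w = (0, 0)\<close>, \<open>x = (s, 0)\<close>, \<open>p = (s, s)\<close>, \<open>q = (s, -s)\<close> one has
  \<open>S(p, q, x, w) = s\<close>.

  For these four points only six bounds matter. Four upper bounds are given by explicit analytic
  discs in the embedded bidisc. The two lower bounds compare points with real coordinates along a
  single coordinate, so they do not need the whole hyperbolic distance (whose triangle inequality
  would have to be shown): it is enough to have, on the disc, one real function that is
  1-Lipschitz for that distance and restricts to \<open>artanh\<close> on the real diameter. Such a function
  is the horofunction of the boundary point 1, and its Lipschitz property is Harnack's inequality,
  a form of the Schwarz lemma (\<open>Harnack_ln_disc\<close>, \<open>kobayashi_dist_ge_horofunction\<close>).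
\<close>

section \<open>Harnack's inequality and a horofunction of the disc\<close>

text \<open>
  The Cayley map centred at \<open>F 0\<close> turns \<open>F\<close> into a self-map of the disc fixing 0, and the
  Schwarz lemma bounds it by \<open>\<bar>\<alpha>\<bar>\<close>. Since \<open>\<bar>\<alpha>\<bar> < 1\<close>, the imaginary parts can be
  dropped from that bound, which leaves \<open>\<bar>a - b\<bar> \<le> \<bar>\<alpha>\<bar> (a + b)\<close> for the real parts
  \<open>a\<close> of \<open>F \<alpha>\<close> and \<open>b\<close> of \<open>F 0\<close>; this bounds the ratio \<open>a / b\<close> on both sides.
\<close>

lemma Harnack_ln_disc:
  assumes F: "F holomorphic_on ball 0 1"
    and pos: "\<And>\<zeta>. cmod \<zeta> < 1 \<Longrightarrow> 0 < Re (F \<zeta>)"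
    and \<alpha>: "cmod \<alpha> < 1"
  shows "\<bar>ln (Re (F \<alpha>)) - ln (Re (F 0))\<bar> \<le> 2 * artanh (cmod \<alpha>)"
proof -
  define c where "c = F 0"
  define G where "G \<zeta> = (F \<zeta> - c) / (F \<zeta> + cnj c)" for \<zeta>
  define r where "r = cmod \<alpha>"
  have c: "0 < Re c" using pos[of 0] by (simp add: c_def)
  have ne: "F \<zeta> + cnj c \<noteq> 0" if "cmod \<zeta> < 1" for \<zeta>
    using pos[OF that] c by (auto simp: complex_eq_iff)
  have "G holomorphic_on ball 0 1"
    unfolding G_def using ne by (intro holomorphic_intros F) auto
  moreover have "G 0 = 0" by (simp add: G_def c_def)
  moreover have "cmod (G \<zeta>) < 1" if "cmod \<zeta> < 1" for \<zeta>
  proof -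
    have "(cmod (F \<zeta> + cnj c))\<^sup>2 - (cmod (F \<zeta> - c))\<^sup>2 = 4 * (Re (F \<zeta>) * Re c)"
      unfolding cmod_power2 by (simp add: power2_eq_square algebra_simps)
    then have "(cmod (F \<zeta> - c))\<^sup>2 < (cmod (F \<zeta> + cnj c))\<^sup>2"
      using mult_pos_pos[OF pos[OF that] c] by linarith
    then have "cmod (F \<zeta> - c) < cmod (F \<zeta> + cnj c)"
      by (rule power2_less_imp_less) simp
    then show ?thesis
      using ne[OF that] by (simp add: G_def norm_divide)
  qed
  ultimately have "cmod (G \<alpha>) \<le> cmod \<alpha>"
    using Schwarz_Lemma(1) \<alpha> by blast
  then have le: "cmod (F \<alpha> - c) \<le> r * cmod (F \<alpha> + cnj c)"
    using ne[OF \<alpha>] by (simp add: G_def norm_divide r_def divide_le_eq)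
  define a b y where "a = Re (F \<alpha>)" and "b = Re c" and "y = Im (F \<alpha>) - Im c"
  have ab: "0 < a" "0 < b" using pos[OF \<alpha>] c by (auto simp: a_def b_def)
  have r: "0 \<le> r" "r < 1" using \<alpha> by (auto simp: r_def)
  have "(cmod (F \<alpha> - c))\<^sup>2 \<le> (r * cmod (F \<alpha> + cnj c))\<^sup>2"
    using le by (rule power_mono) simp
  then have "(a - b)\<^sup>2 + y\<^sup>2 \<le> r\<^sup>2 * ((a + b)\<^sup>2 + y\<^sup>2)"
    unfolding power_mult_distrib cmod_power2 by (simp add: a_def b_def y_def)
  moreover have "r\<^sup>2 * y\<^sup>2 \<le> 1 * y\<^sup>2"
    using r by (intro mult_right_mono) (auto simp: power_le_one)
  ultimately have "(a - b)\<^sup>2 \<le> r\<^sup>2 * (a + b)\<^sup>2"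
    unfolding distrib_left[of "r\<^sup>2"] by linarith
  then have "\<bar>a - b\<bar>\<^sup>2 \<le> (r * (a + b))\<^sup>2"
    by (simp only: power_mult_distrib power2_abs)
  then have "\<bar>a - b\<bar> \<le> r * (a + b)"
    by (rule power2_le_imp_le) (use r ab in simp)
  then have "a \<le> b * ((1 + r) / (1 - r))" "b \<le> a * ((1 + r) / (1 - r))"
    using r by (auto simp: field_simps abs_le_iff)
  then have "ln a \<le> ln (b * ((1 + r) / (1 - r)))" "ln b \<le> ln (a * ((1 + r) / (1 - r)))"
    using ab by simp_all
  moreover have "0 < (1 + r) / (1 - r)" using r by simp
  ultimately have "ln a \<le> ln b + ln ((1 + r) / (1 - r))" "ln b \<le> ln a + ln ((1 + r) / (1 - r))"
    using ab by (simp_all only: ln_mult_pos)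
  then show ?thesis
    by (simp add: a_def b_def c_def r_def artanh_def abs_le_iff)
qed

text \<open>
  Up to sign, this is the Busemann function of the disc at the boundary point 1: the argument of
  the logarithm is the Poisson kernel \<open>(1 - \<bar>z\<bar>\<^sup>2) / \<bar>1 - z\<bar>\<^sup>2\<close>.
\<close>

definition horofunction :: "complex \<Rightarrow> real" where
  "horofunction z = ln (Re ((1 + z) / (1 - z))) / 2"

lemma horofunction_of_real: "horofunction (of_real t) = artanh t"
proof -
  have "(1 + of_real t) / (1 - of_real t) = (of_real ((1 + t) / (1 - t)) :: complex)"
    by simp
  then show ?thesis
    unfolding horofunction_def artanh_def by (simp only: Re_complex_of_real)
qed

lemma Re_Cayley_pos:
  assumes "cmod z < 1"
  shows "0 < Re ((1 + z) / (1 - z))"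
proof -
  have "Re ((1 + z) / (1 - z)) = (1 - (cmod z)\<^sup>2) / (cmod (1 - z))\<^sup>2"
    unfolding Re_divide cmod_power2 by (simp add: power2_eq_square algebra_simps)
  moreover have "(cmod z)\<^sup>2 < 1"
    using assms by (simp add: power_less_one_iff)
  moreover have "z \<noteq> 1" using assms by auto
  ultimately show ?thesis by simp
qed

lemma horofunction_lipschitz:
  assumes f: "f holomorphic_on ball 0 1"
    and bound: "\<And>\<zeta>. cmod \<zeta> < 1 \<Longrightarrow> cmod (f \<zeta>) < 1"
    and \<alpha>: "cmod \<alpha> < 1"
  shows "\<bar>horofunction (f 0) - horofunction (f \<alpha>)\<bar> \<le> artanh (cmod \<alpha>)"
proof -
  have "(\<lambda>\<zeta>. (1 + f \<zeta>) / (1 - f \<zeta>)) holomorphic_on ball 0 1"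
    using bound by (intro holomorphic_intros f) force
  from Harnack_ln_disc[OF this Re_Cayley_pos[OF bound] \<alpha>] show ?thesis
    by (simp add: horofunction_def abs_le_iff)
qed


section \<open>The bidisc as a retract of the tetrablock\<close>

definition bidisc_embedding :: "complex \<Rightarrow> complex \<Rightarrow> complex^3" where
  "bidisc_embedding a b = vector [a, b, a * b]"

lemma bidisc_embedding_nth [simp]:
  "bidisc_embedding a b $ 1 = a" "bidisc_embedding a b $ 2 = b" "bidisc_embedding a b $ 3 = a * b"
  by (simp_all add: bidisc_embedding_def)

lemma bidisc_embedding_in_tetrablock:
  assumes "cmod a < 1" "cmod b < 1"
  shows "bidisc_embedding a b \<in> tetrablock"
proof -
  define A :: "complex^2^2" where "A = vector [vector [a, 0], vector [0, b]]"
  define m where "m = max (cmod a) (cmod b)"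
  have "0 \<le> m" by (simp add: m_def le_max_iff_disj)
  have "norm (A *v v) \<le> m * norm v" for v
  proof -
    have "(cmod (a * v $ 1))\<^sup>2 + (cmod (b * v $ 2))\<^sup>2
        \<le> (m * cmod (v $ 1))\<^sup>2 + (m * cmod (v $ 2))\<^sup>2"
      unfolding norm_mult m_def
      by (intro add_mono power_mono mult_right_mono) auto
    then have "sqrt ((cmod (a * v $ 1))\<^sup>2 + (cmod (b * v $ 2))\<^sup>2)
        \<le> sqrt (m\<^sup>2 * ((cmod (v $ 1))\<^sup>2 + (cmod (v $ 2))\<^sup>2))"
      by (simp add: power_mult_distrib distrib_left)
    then show ?thesis
      by (simp add: norm_vec_def L2_set_def sum_2 matrix_vector_mult_def A_def real_sqrt_mult \<open>0 \<le> m\<close>)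
  qed
  then have "onorm ((*v) A) \<le> m" by (rule onorm_le)
  moreover have "transpose A = A"
    by (simp add: A_def transpose_def vec_eq_iff forall_2)
  ultimately have "A \<in> R_II" using assms by (auto simp: R_II_def m_def)
  moreover have "bidisc_embedding a b = tetra_map (sym_coords A)"
    by (simp add: vec_eq_iff forall_3 tetra_map_def sym_coords_def A_def)
  ultimately show ?thesis by (auto simp: tetrablock_def)
qed

lemma R_II_entry_less_1:
  assumes "A \<in> R_II"
  shows "cmod (A $ i $ j) < 1"
proof -
  have "norm (A *v axis j 1) \<le> onorm ((*v) A) * norm (axis j (1::complex) :: complex^2)"
    by (intro onorm matrix_vector_mul_bounded_linear)
  moreover have "cmod ((A *v axis j 1) $ i) \<le> norm (A *v axis j 1)"
    by (rule Finite_Cartesian_Product.norm_nth_le)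
  moreover have "(A *v axis j 1) $ i = A $ i $ j"
    by (simp add: matrix_vector_mult_def axis_def if_distrib cong: if_cong)
  moreover have "norm (axis j (1::complex) :: complex^2) = 1"
    by simp
  ultimately show ?thesis using assms by (simp add: R_II_def)
qed

lemma tetrablock_coord_less_1:
  assumes "z \<in> tetrablock" "i \<in> {1, 2}"
  shows "cmod (z $ i) < 1"
  using assms R_II_entry_less_1 by (auto simp: tetrablock_def tetra_map_def sym_coords_def)


section \<open>Bounds for the Kobayashi distance\<close>

text \<open>
  The absolute difference of the values of one real function is a pseudodistance for free, and
  this one lies below the Lempert function because the first two coordinates of an analytic disc
  in the tetrablock are holomorphic self-maps of the unit disc.
\<close>

lemma kobayashi_dist_ge_horofunction:
  assumes z: "z \<in> tetrablock" and w: "w \<in> tetrablock" and i: "i \<in> {1, 2}"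
  shows "\<bar>horofunction (z $ i) - horofunction (w $ i)\<bar> \<le> kobayashi_dist tetrablock z w"
proof -
  let ?d = "\<lambda>z w :: complex^3. \<bar>horofunction (z $ i) - horofunction (w $ i)\<bar>"
  have "pseudodistance_on tetrablock ?d"
    by (auto simp: pseudodistance_on_def)
  moreover have "below_lempert tetrablock ?d"
    unfolding below_lempert_def lempert_def
  proof (intro ballI INF_greatest)
    fix z w \<alpha>
    assume "\<alpha> \<in> {\<alpha> \<in> ball 0 1. \<exists>f \<in> holomorphic_discs tetrablock. f 0 = z \<and> f \<alpha> = w}"
    then obtain f where \<alpha>: "cmod \<alpha> < 1" and f: "f \<in> holomorphic_discs tetrablock"
      and zw: "f 0 = z" "f \<alpha> = w"
      by auto
    have "\<bar>horofunction (f 0 $ i) - horofunction (f \<alpha> $ i)\<bar> \<le> artanh (cmod \<alpha>)"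
    proof (rule horofunction_lipschitz[OF _ _ \<alpha>])
      show "(\<lambda>\<zeta>. f \<zeta> $ i) holomorphic_on ball 0 1"
        using f by (simp add: holomorphic_discs_def)
      show "cmod (f \<zeta> $ i) < 1" if "cmod \<zeta> < 1" for \<zeta>
        using f that i by (intro tetrablock_coord_less_1) (auto simp: holomorphic_discs_def)
    qed
    then show "ereal (?d z w) \<le> ereal (artanh (cmod \<alpha>))"
      by (simp add: zw)
  qed
  ultimately show ?thesis
    using kobayashi_dist_tetrablock(3)[of ?d] z w by simp
qed

lemma kobayashi_dist_bidisc_le:
  assumes a: "a holomorphic_on ball 0 1" "\<And>\<zeta>. cmod \<zeta> < 1 \<Longrightarrow> cmod (a \<zeta>) < 1"
    and b: "b holomorphic_on ball 0 1" "\<And>\<zeta>. cmod \<zeta> < 1 \<Longrightarrow> cmod (b \<zeta>) < 1"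
    and t: "0 \<le> t" "t < 1"
  shows "kobayashi_dist tetrablock (bidisc_embedding (a 0) (b 0))
      (bidisc_embedding (a (of_real t)) (b (of_real t))) \<le> artanh t"
proof -
  define f where "f \<zeta> = bidisc_embedding (a \<zeta>) (b \<zeta>)" for \<zeta>
  have mem: "f \<zeta> \<in> tetrablock" if "cmod \<zeta> < 1" for \<zeta>
    unfolding f_def using a b that by (intro bidisc_embedding_in_tetrablock) auto
  have "(\<lambda>\<zeta>. f \<zeta> $ i) holomorphic_on ball 0 1" for i
    using exhaust_3[of i] a b by (auto simp: f_def intro!: holomorphic_intros)
  then have "f \<in> holomorphic_discs tetrablock"
    using mem by (auto simp: holomorphic_discs_def)
  then have "lempert tetrablock (f 0) (f (of_real t)) \<le> ereal (artanh (cmod (of_real t)))"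
    unfolding lempert_def using t by (intro INF_lower) auto
  moreover have "ereal (kobayashi_dist tetrablock (f 0) (f (of_real t)))
      \<le> lempert tetrablock (f 0) (f (of_real t))"
    using kobayashi_dist_tetrablock(2) t mem by (simp add: below_lempert_def)
  ultimately have "ereal (kobayashi_dist tetrablock (f 0) (f (of_real t))) \<le> ereal (artanh t)"
    using t order_trans by fastforce
  then show ?thesis by (simp add: f_def)
qed


section \<open>Four points with large Gromov defect\<close>

text \<open>
  In the coordinates \<open>artanh a\<close>, \<open>artanh b\<close> the points \<open>p, q\<close> are two ends of a side of a square
  with centre \<open>w\<close>, and \<open>x\<close> is the midpoint of that side. In the maximum norm both \<open>w\<close> and \<open>x\<close>
  are midpoints of geodesics from \<open>p\<close> to \<open>q\<close>, but they are half a side apart.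
\<close>

lemma tetrablock_gromov_S_large:
  assumes t: "0 \<le> t" "t < 1"
  defines "e \<equiv> \<lambda>a b. bidisc_embedding (of_real a) (of_real b)"
  shows "artanh t \<le> gromov_S (kobayashi_dist tetrablock) (e t t) (e t (- t)) (e t 0) (e 0 0)"
proof -
  let ?k = "kobayashi_dist tetrablock"
  have mem: "e a b \<in> tetrablock" if "a \<in> {t, 0}" "b \<in> {t, - t, 0}" for a b
    unfolding e_def using that t by (intro bidisc_embedding_in_tetrablock) auto
  have sym: "?k z w = ?k w z" if "z \<in> tetrablock" "w \<in> tetrablock" for z w
    using kobayashi_dist_tetrablock(1) that by (auto simp: pseudodistance_on_def)
  have minus: "horofunction (- of_real t) = - artanh t"
    using horofunction_of_real[of "- t"] t by simp
  \<comment> \<open>upper bounds from the discs \<open>(\<zeta>, \<zeta>)\<close>, \<open>(\<zeta>, -\<zeta>)\<close>, \<open>(t, \<zeta>)\<close> and \<open>(t, -\<zeta>)\<close> at \<open>\<zeta> = t\<close>\<close>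
  have wp: "?k (e 0 0) (e t t) \<le> artanh t"
    using kobayashi_dist_bidisc_le[of "\<lambda>\<zeta>. \<zeta>" "\<lambda>\<zeta>. \<zeta>" t] t
    by (simp add: e_def)
  have wq: "?k (e 0 0) (e t (- t)) \<le> artanh t"
    using kobayashi_dist_bidisc_le[of "\<lambda>\<zeta>. \<zeta>" "\<lambda>\<zeta>. - \<zeta>" t] t
    by (simp add: e_def holomorphic_intros)
  have xp: "?k (e t 0) (e t t) \<le> artanh t"
    using kobayashi_dist_bidisc_le[of "\<lambda>_. of_real t" "\<lambda>\<zeta>. \<zeta>" t] t
    by (simp add: e_def)
  have xq: "?k (e t 0) (e t (- t)) \<le> artanh t"
    using kobayashi_dist_bidisc_le[of "\<lambda>_. of_real t" "\<lambda>\<zeta>. - \<zeta>" t] t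
    by (simp add: e_def holomorphic_intros)
  have wx: "artanh t \<le> ?k (e 0 0) (e t 0)"
    using kobayashi_dist_ge_horofunction[OF mem[of 0 0] mem[of t 0], of 1]
      horofunction_of_real[of 0]
    by (simp add: e_def horofunction_of_real)
  have pq: "2 * artanh t \<le> ?k (e t t) (e t (- t))"
    using kobayashi_dist_ge_horofunction[OF mem[of t t] mem[of t "- t"], of 2]
    by (simp add: e_def horofunction_of_real minus)
  show ?thesis
    using wp wq xp xq wx pq
      sym[OF mem[of t t] mem[of 0 0]] sym[OF mem[of t 0] mem[of 0 0]]
      sym[OF mem[of t t] mem[of t 0]]
    unfolding gromov_S_def gromov_product_def by (simp add: min_def)
qed

theorem proposition4:
  shows "\<not> gromov_k_hyperbolic tetrablock"
proof
  assume "gromov_k_hyperbolic tetrablock"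
  then obtain M where M: "\<And>p q x w. \<lbrakk>p \<in> tetrablock; q \<in> tetrablock; x \<in> tetrablock; w \<in> tetrablock\<rbrakk>
      \<Longrightarrow> gromov_S (kobayashi_dist tetrablock) p q x w \<le> M"
    unfolding gromov_k_hyperbolic_def gromov_hyperbolic_on_def bdd_above_def by blast
  define t where "t = tanh (\<bar>M\<bar> + 1)"
  have t: "0 \<le> t" "t < 1"
    by (simp_all add: t_def tanh_real_lt_1)
  have "artanh t \<le> M"
    by (rule order_trans[OF tetrablock_gromov_S_large[OF t] M])
      (use t in \<open>auto intro!: bidisc_embedding_in_tetrablock\<close>)
  then show False by (simp add: t_def artanh_tanh_real)
qed

end
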